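(* Let $ABC$ be a (nondegenerate) triangle in the Euclidean plane. If three points $R$, $S$, $T$ are chosen independently and uniformly at random on the sides $AB$, $BC$, $CA$ respectively, then the expected area of the triangle $RST$ is one-fourth of the area of $ABC$.
   Context: "Uniformly on a side" means uniformly with respect to length on the closed segment, i.e. the point is $X + u(Y-X)$, where $X,Y$ are the endpoints of the side and $u$ is uniform on $[0,1]$. *)

theory Defs
  imports "HOL-Probability.Probability"
begin

definition uniform_on_side :: "real ^ 2 \<Rightarrow> real ^ 2 \<Rightarrow> (real ^ 2) measure" where
  "uniform_on_side X Y =
     distr (uniform_measure lborel {0..1}) borel (\<lambda>u. X + u *\<^sub>R (Y - X))"

definition triangle_area :: "real ^ 2 \<Rightarrow> real ^ 2 \<Rightarrow> real ^ 2 \<Rightarrow> real" where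
  "triangle_area P Q R = measure lborel (convex hull {P, Q, R})"

end

theory Submission imports Defs begin

text \<open>
  Write \<open>R = A + u (B - A)\<close>, \<open>S = B + v (C - B)\<close>, \<open>T = C + w (A - C)\<close> with parameters
  \<open>u, v, w\<close> in \<open>[0,1]\<close>. The signed area of a triangle is an affine function of each vertex, and
  expanding it gives (lemma \<open>triangle_area_points_on_sides\<close>)

  \<open>area RST = (u v w + (1 - u) (1 - v) (1 - w)) area ABC\<close>.

  The factor is nonnegative on the unit cube, so \<open>RST\<close> never has the orientation opposite to \<open>ABC\<close>
  and the absolute value in the area formula disappears. The area is thus a polynomial in the
  parameters, affine in each one, and only their means enter its expectation. The parameters
  are independent with mean \<open>1/2\<close>, and the expected factor is
  \<open>1/2^3 + 1/2^3 = 1/4\<close>.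

  The hypotheses speak of the points, so the parameters are recovered from them by the measurable
  projection \<open>segment_param\<close>. Being functions of the separate points, they inherit independence
  (lemma \<open>segment_param_of_uniform\<close> gives the rest: almost surely they describe the points and lie
  in \<open>[0,1]\<close>, and their mean is \<open>1/2\<close>).
\<close>

text \<open>
  The orthogonal projection onto the line through \<open>X\<close> and \<open>Y\<close>, read off in the coordinate that
  is \<open>0\<close> at \<open>X\<close> and \<open>1\<close> at \<open>Y\<close>. It inverts the parametrisation of the side, but is defined
  and continuous on the whole plane, so it can be composed with any random point.
\<close>

definition segment_param :: "real ^ 2 \<Rightarrow> real ^ 2 \<Rightarrow> real ^ 2 \<Rightarrow> real" where
  "segment_param X Y Z = ((Z - X) \<bullet> (Y - X)) / ((Y - X) \<bullet> (Y - X))"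

lemma segment_param_affine:
  assumes "X \<noteq> Y"
  shows "segment_param X Y (X + u *\<^sub>R (Y - X)) = u"
  using assms by (simp add: segment_param_def)

lemma segment_param_measurable [measurable]: "segment_param X Y \<in> borel_measurable borel"
  unfolding segment_param_def by measurable

lemma integral_uniform_unit_interval:
  shows "(\<integral>u. u \<partial>uniform_measure lborel {0..1::real}) = 1 / 2"
proof -
  have "uniform_measure lborel {0..1::real} = density lborel (\<lambda>u. ennreal (indicator {0..1} u))"
    by (simp add: uniform_measure_def divide_ennreal_def ennreal_indicator)
  then have "(\<integral>u. u \<partial>uniform_measure lborel {0..1::real}) = (\<integral>u. indicator {0..1} u * u \<partial>lborel)"
    by (simp add: integral_real_density)
  also have "\<dots> = (\<integral>u. u ^ 1 * indicator {0..1} u \<partial>lborel)"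
    by (simp add: mult.commute)
  also have "\<dots> = 1 / 2"
    by (subst integral_power) simp_all
  finally show ?thesis .
qed

context prob_space begin

text \<open>
  Pulling the law of the point back along the affine parametrisation turns statements about
  \<open>segment_param\<close> into statements about the identity on the uniform unit interval. The point itself
  lies on the side only almost surely, since only its distribution is known.
\<close>

lemma segment_param_of_uniform:
  assumes XY: "X \<noteq> Y" and Z [measurable]: "Z \<in> borel_measurable M"
    and unif: "distr M borel Z = uniform_on_side X Y"
    and u_def: "u = (\<lambda>\<omega>. segment_param X Y (Z \<omega>))"
  shows "AE \<omega> in M. Z \<omega> = X + u \<omega> *\<^sub>R (Y - X) \<and> u \<omega> \<in> {0..1}"
    and "integrable M u" and "expectation u = 1 / 2"
proof -
  let ?U = "uniform_measure lborel {0..1::real}"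
  have "AE Z in uniform_on_side X Y.
      Z = X + segment_param X Y Z *\<^sub>R (Y - X) \<and> segment_param X Y Z \<in> {0..1}"
    unfolding uniform_on_side_def
    by (subst AE_distr_iff) (auto simp: segment_param_affine[OF XY] intro!: AE_uniform_measureI)
  then show ae: "AE \<omega> in M. Z \<omega> = X + u \<omega> *\<^sub>R (Y - X) \<and> u \<omega> \<in> {0..1}"
    unfolding unif[symmetric] u_def by (subst (asm) AE_distr_iff) auto
  show "integrable M u"
    using ae by (intro integrable_const_bound[where B = 1]) (auto simp: u_def)
  have "expectation u = (\<integral>z. segment_param X Y z \<partial>distr M borel Z)"
    unfolding u_def by (simp add: integral_distr)
  also have "\<dots> = (\<integral>t. t \<partial>?U)"
    unfolding unif uniform_on_side_def
    by (subst integral_distr) (auto simp: segment_param_affine[OF XY])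
  finally show "expectation u = 1 / 2"
    by (simp add: integral_uniform_unit_interval)
qed

lemma expectation_mult_indep3:
  fixes X Y Z :: "'a \<Rightarrow> real"
  assumes ind: "indep_vars (\<lambda>_. borel) (\<lambda>i. [X, Y, Z] ! i) {0, 1, 2}"
    and int: "integrable M X" "integrable M Y" "integrable M Z"
  shows "integrable M (\<lambda>\<omega>. X \<omega> * Y \<omega> * Z \<omega>)"
    and "expectation (\<lambda>\<omega>. X \<omega> * Y \<omega> * Z \<omega>) = expectation X * expectation Y * expectation Z"
proof -
  have i: "integrable M ([X, Y, Z] ! i)" if "i \<in> {0, 1, 2}" for i
    using int that by auto
  show "integrable M (\<lambda>\<omega>. X \<omega> * Y \<omega> * Z \<omega>)"
    using indep_vars_integrable[OF _ ind i] by (simp add: mult.assoc)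
  show "expectation (\<lambda>\<omega>. X \<omega> * Y \<omega> * Z \<omega>) = expectation X * expectation Y * expectation Z"
    using indep_vars_lebesgue_integral[OF _ ind i] by (simp add: mult.assoc)
qed

end

lemma borel_measurable_vec_nth [measurable (raw)]:
  fixes f :: "'a \<Rightarrow> real ^ 'n"
  assumes [measurable]: "f \<in> borel_measurable M"
  shows "(\<lambda>x. f x $ i) \<in> borel_measurable M"
proof -
  have "(\<lambda>x. f x \<bullet> axis i 1) \<in> borel_measurable M"
    by measurable
  then show ?thesis
    by (simp add: inner_axis)
qed

lemma triangle_area_formula:
  "triangle_area P Q R =
     \<bar>(R $ 1 - P $ 1) * (Q $ 2 - P $ 2) - (Q $ 1 - P $ 1) * (R $ 2 - P $ 2)\<bar> / 2"
  unfolding triangle_area_def by (subst content_triangle[symmetric]) simp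

text \<open>
  In barycentric coordinates with respect to \<open>A, B, C\<close> the three points are the rows
  \<open>(1 - u, u, 0)\<close>, \<open>(0, 1 - v, v)\<close>, \<open>(w, 0, 1 - w)\<close>, and the factor is the determinant of this
  matrix: the only two permutations avoiding the zeros are the identity and a 3-cycle, both even.
\<close>

lemma triangle_area_points_on_sides:
  fixes u v w :: real
  assumes "u \<in> {0..1}" "v \<in> {0..1}" "w \<in> {0..1}"
  shows "triangle_area (A + u *\<^sub>R (B - A)) (B + v *\<^sub>R (C - B)) (C + w *\<^sub>R (A - C)) =
    (u * v * w + (1 - u) * (1 - v) * (1 - w)) * triangle_area A B C"
    (is "triangle_area ?R ?S ?T = ?k * _")
proof -
  \<comment> \<open>Minus twice the signed area; the factor comes out before any absolute value is taken.\<close>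
  let ?D = "\<lambda>P Q R :: real ^ 2.
    (R $ 1 - P $ 1) * (Q $ 2 - P $ 2) - (Q $ 1 - P $ 1) * (R $ 2 - P $ 2)"
  have "?D ?R ?S ?T = ?k * ?D A B C"
    by (simp add: algebra_simps)
  moreover have "?k \<ge> 0"
    using assms by (intro add_nonneg_nonneg mult_nonneg_nonneg) auto
  ultimately show ?thesis
    by (simp only: triangle_area_formula abs_mult abs_of_nonneg)
qed

theorem theorem2:
  fixes A B C :: "real ^ 2"
    and M :: "'a measure"
    and R S T :: "'a \<Rightarrow> real ^ 2"
  assumes "\<not> collinear {A, B, C}"
    and "prob_space M"
    and "prob_space.indep_vars M (\<lambda>_. borel) (\<lambda>i. [R, S, T] ! i) {0, 1, 2}"
    and "distr M borel R = uniform_on_side A B"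
    and "distr M borel S = uniform_on_side B C"
    and "distr M borel T = uniform_on_side C A"
  shows "integrable M (\<lambda>\<omega>. triangle_area (R \<omega>) (S \<omega>) (T \<omega>)) \<and>
         prob_space.expectation M (\<lambda>\<omega>. triangle_area (R \<omega>) (S \<omega>) (T \<omega>))
           = triangle_area A B C / 4"
proof -
  interpret prob_space M by fact
  note ind = assms(3)
  have ne: "A \<noteq> B" "B \<noteq> C" "C \<noteq> A"
    using assms(1) by (auto simp: insert_commute)
  have "random_variable borel ([R, S, T] ! i)" if "i \<in> {0, 1, 2}" for i
    using ind that unfolding indep_vars_def by blast
  from this[of 0] this[of 1] this[of 2]
  have rv [measurable]: "random_variable borel R" "random_variable borel S" "random_variable borel T"
    by simp_all
  define u where "u = (\<lambda>\<omega>. segment_param A B (R \<omega>))"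
  define v where "v = (\<lambda>\<omega>. segment_param B C (S \<omega>))"
  define w where "w = (\<lambda>\<omega>. segment_param C A (T \<omega>))"
  note U = segment_param_of_uniform[OF ne(1) rv(1) assms(4) u_def]
  note V = segment_param_of_uniform[OF ne(2) rv(2) assms(5) v_def]
  note W = segment_param_of_uniform[OF ne(3) rv(3) assms(6) w_def]
  have int [simp, measurable]: "integrable M u" "integrable M v" "integrable M w"
    by (fact U(2) V(2) W(2))+
  have exp: "expectation u = 1 / 2" "expectation v = 1 / 2" "expectation w = 1 / 2"
    by (fact U(3) V(3) W(3))+
  have "indep_vars (\<lambda>_. borel)
      (\<lambda>i \<omega>. segment_param ([A, B, C] ! i) ([B, C, A] ! i) (([R, S, T] ! i) \<omega>)) {0, 1, 2}"
    by (rule indep_vars_compose2[OF ind]) simp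
  also have "?this \<longleftrightarrow> indep_vars (\<lambda>_. borel) (\<lambda>i. [u, v, w] ! i) {0, 1, 2}"
    by (intro indep_vars_cong) (auto simp: u_def v_def w_def)
  finally have ind_uvw: "indep_vars (\<lambda>_. borel) (\<lambda>i. [u, v, w] ! i) {0, 1, 2}" .
  have "indep_vars (\<lambda>_. borel) (\<lambda>i \<omega>. 1 - ([u, v, w] ! i) \<omega>) {0, 1, 2}"
    by (rule indep_vars_compose2[OF ind_uvw]) simp
  also have "?this \<longleftrightarrow> indep_vars (\<lambda>_. borel)
      (\<lambda>i. [\<lambda>\<omega>. 1 - u \<omega>, \<lambda>\<omega>. 1 - v \<omega>, \<lambda>\<omega>. 1 - w \<omega>] ! i) {0, 1, 2}"
    by (intro indep_vars_cong) auto
  finally have ind_compl: "indep_vars (\<lambda>_. borel)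
      (\<lambda>i. [\<lambda>\<omega>. 1 - u \<omega>, \<lambda>\<omega>. 1 - v \<omega>, \<lambda>\<omega>. 1 - w \<omega>] ! i) {0, 1, 2}" .
  note P = expectation_mult_indep3[OF ind_uvw int]
  have "integrable M (\<lambda>\<omega>. 1 - u \<omega>)" "integrable M (\<lambda>\<omega>. 1 - v \<omega>)" "integrable M (\<lambda>\<omega>. 1 - w \<omega>)"
    by simp_all
  note Q = expectation_mult_indep3[OF ind_compl this]
  let ?k = "\<lambda>\<omega>. u \<omega> * v \<omega> * w \<omega> + (1 - u \<omega>) * (1 - v \<omega>) * (1 - w \<omega>)"
  have int_k: "integrable M ?k"
    using P(1) Q(1) by (rule Bochner_Integration.integrable_add)
  have "expectation ?k = 1 / 4"
    by (simp add: Bochner_Integration.integral_add[OF P(1) Q(1)] P(2) Q(2) exp prob_space)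
  then have exp_area: "expectation (\<lambda>\<omega>. ?k \<omega> * triangle_area A B C) = triangle_area A B C / 4"
    by simp
  have area_eq: "AE \<omega> in M. triangle_area (R \<omega>) (S \<omega>) (T \<omega>) = ?k \<omega> * triangle_area A B C"
  proof -
    from U(1) V(1) W(1) show ?thesis
    proof eventually_elim
      case (elim \<omega>)
      then show ?case
        using triangle_area_points_on_sides[of "u \<omega>" "v \<omega>" "w \<omega>" A B C] by metis
    qed
  qed
  \<comment> \<open>Almost sure equality carries over integrability only between measurable functions.\<close>
  have meas: "(\<lambda>\<omega>. triangle_area (R \<omega>) (S \<omega>) (T \<omega>)) \<in> borel_measurable M"
    unfolding triangle_area_formula by measurable
  have meas_k: "(\<lambda>\<omega>. ?k \<omega> * triangle_area A B C) \<in> borel_measurable M"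
    using int_k by simp
  have "integrable M (\<lambda>\<omega>. triangle_area (R \<omega>) (S \<omega>) (T \<omega>))"
    using integrable_cong_AE[OF meas meas_k area_eq] int_k by simp
  moreover have "expectation (\<lambda>\<omega>. triangle_area (R \<omega>) (S \<omega>) (T \<omega>)) = triangle_area A B C / 4"
    using integral_cong_AE[OF meas meas_k area_eq] exp_area by simp
  ultimately show ?thesis ..
qed

end
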